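(* Let $A\in\mathbb{R}^{n\times n}$, $C\in\mathbb{R}^{n_y\times n}$, $B_d\in\mathbb{R}^{n\times n_d}$, and consider the system with unknown input $d(t)\in\mathbb{R}^{n_d}$, $$\dot x(t)=Ax(t)+B_dd(t),\qquad y(t)=Cx(t).$$ Let $G\in\mathbb{R}^{n\times n}$, $L,E,N_c\in\mathbb{R}^{n\times n_y}$, $\theta\in\mathbb{R}^{n_y\times n_y}$, and suppose the cubic observer $$\dot w_c(t)=Gw_c(t)+Ly(t)-\big(e_c^T(t)C^T\theta Ce_c(t)\big)N_cCe_c(t),\qquad \hat x_c(t)=w_c(t)+Ey(t),$$ with $e_c(t)=x(t)-\hat x_c(t)$, is used to estimate the state $x$ of this system. Suppose there exist $P=P^T>0$ in $\mathbb{R}^{n\times n}$ and $C^T\theta C\ge 0$ such that (i) $(I-EC)A-G(I-EC)-LC=0$; (ii) there is no vector $v\in\mathbb{R}^n$, $v\neq 0$, with $Gv+(v^TC^T\theta Cv)N_cCv=0$; (iii) $G^TP+PG<0$ and $PN_cC+C^TN_c^TP<0$; (iv) $(I-EC)B_d=0$. Then the estimation error dynamics (the dynamics of $e_c$) is stable.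
   Context: Matrix inequalities such as $M>0$, $M\ge 0$, $M<0$ are in the sense of (semi)definiteness of symmetric matrices. The matrix $B_d$ is known while the input $d$ is unknown. The term "stable" is used without a further definition; the result is presented as a convergence criterion for the observer. *)

theory Defs
  imports "HOL-Analysis.Analysis"
begin

definition sym_pos_def :: "real ^ 'n ^ 'n \<Rightarrow> bool" where
  "sym_pos_def M \<longleftrightarrow> transpose M = M \<and> (\<forall>v. v \<noteq> 0 \<longrightarrow> v \<bullet> (M *v v) > 0)"

definition sym_pos_semidef :: "real ^ 'n ^ 'n \<Rightarrow> bool" where
  "sym_pos_semidef M \<longleftrightarrow> transpose M = M \<and> (\<forall>v. v \<bullet> (M *v v) \<ge> 0)"

definition sym_neg_def :: "real ^ 'n ^ 'n \<Rightarrow> bool" where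
  "sym_neg_def M \<longleftrightarrow> transpose M = M \<and> (\<forall>v. v \<noteq> 0 \<longrightarrow> v \<bullet> (M *v v) < 0)"

(* Solutions that are only defined up to a finite time are admitted, so that the stability
   notions below also speak about motions that might escape in finite time. *)
definition time_domain :: "real set \<Rightarrow> bool" where
  "time_domain J \<longleftrightarrow> J = {0..} \<or> (\<exists>T>0. J = {0..<T})"

definition plant_solution ::
  "real ^ 'n ^ 'n \<Rightarrow> real ^ 'd ^ 'n \<Rightarrow> real ^ 'n ^ 'y \<Rightarrow> real set \<Rightarrow>
   (real \<Rightarrow> real ^ 'd) \<Rightarrow> (real \<Rightarrow> real ^ 'n) \<Rightarrow> (real \<Rightarrow> real ^ 'y) \<Rightarrow> bool" where
  "plant_solution A Bd C J d x y \<longleftrightarrow>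
     (\<forall>t\<in>J. (x has_vector_derivative (A *v x t + Bd *v d t)) (at t within J)
           \<and> y t = C *v x t)"

definition cubic_observer_solution ::
  "real ^ 'n ^ 'y \<Rightarrow> real ^ 'n ^ 'n \<Rightarrow> real ^ 'y ^ 'n \<Rightarrow> real ^ 'y ^ 'n \<Rightarrow> real ^ 'y ^ 'n \<Rightarrow>
   real ^ 'y ^ 'y \<Rightarrow> real set \<Rightarrow> (real \<Rightarrow> real ^ 'y) \<Rightarrow> (real \<Rightarrow> real ^ 'n) \<Rightarrow>
   (real \<Rightarrow> real ^ 'n) \<Rightarrow> (real \<Rightarrow> real ^ 'n) \<Rightarrow> bool" where
  "cubic_observer_solution C G L E Nc \<theta> J y e w xhat \<longleftrightarrow>
     (\<forall>t\<in>J. (w has_vector_derivative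
              (G *v w t + L *v y t
                - (e t \<bullet> ((transpose C ** \<theta> ** C) *v e t)) *\<^sub>R ((Nc ** C) *v e t)))
              (at t within J)
           \<and> xhat t = w t + E *v y t)"

(* The motions (J, e) of the estimation error: all error signals e on a time domain J that
   arise from the plant interconnected with the observer, for arbitrary plant and observer
   initial states and an arbitrary unknown input d. *)
definition error_dynamics ::
  "real ^ 'n ^ 'n \<Rightarrow> real ^ 'd ^ 'n \<Rightarrow> real ^ 'n ^ 'y \<Rightarrow> real ^ 'n ^ 'n \<Rightarrow> real ^ 'y ^ 'n \<Rightarrow>
   real ^ 'y ^ 'n \<Rightarrow> real ^ 'y ^ 'n \<Rightarrow> real ^ 'y ^ 'y \<Rightarrow> (real set \<times> (real \<Rightarrow> real ^ 'n)) set" where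
  "error_dynamics A Bd C G L E Nc \<theta> =
     {(J, e). time_domain J \<and>
        (\<exists>d x y w xhat.
           plant_solution A Bd C J d x y \<and>
           cubic_observer_solution C G L E Nc \<theta> J y e w xhat \<and>
           (\<forall>t\<in>J. e t = x t - xhat t))}"

definition lyapunov_stable :: "(real set \<times> (real \<Rightarrow> 'a::real_normed_vector)) set \<Rightarrow> bool" where
  "lyapunov_stable S \<longleftrightarrow>
     (\<forall>\<epsilon>>0. \<exists>\<delta>>0. \<forall>(J, e)\<in>S. norm (e 0) < \<delta> \<longrightarrow> (\<forall>t\<in>J. norm (e t) < \<epsilon>))"

(* Boundedness of every motion, also of those on a bounded time domain, excludes finite
   escape times; every motion defined for all t \<ge> 0 has to converge to the origin. *)
definition globally_attractive :: "(real set \<times> (real \<Rightarrow> 'a::real_normed_vector)) set \<Rightarrow> bool" where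
  "globally_attractive S \<longleftrightarrow>
     (\<forall>(J, e)\<in>S. bounded (e ` J) \<and> (J = {0..} \<longrightarrow> (e \<longlongrightarrow> 0) at_top))"

definition globally_asymptotically_stable ::
  "(real set \<times> (real \<Rightarrow> 'a::real_normed_vector)) set \<Rightarrow> bool" where
  "globally_asymptotically_stable S \<longleftrightarrow> lyapunov_stable S \<and> globally_attractive S"

end

theory Submission
  imports Defs
begin

text \<open>
  Conditions (i) and (iv) decouple the error from the state and from the unknown input: since
  \<open>e = (I - E C) x - w\<close>, the error obeys the autonomous equation
  \<open>e' = G e + q(e) N\<^sub>c C e\<close>, where \<open>q(e) = e\<^sup>T C\<^sup>T \<theta> C e\<close>
  (lemma \<open>error_dynamics_ode\<close>).  The quadratic form \<open>V(e) = e\<^sup>T P e\<close> is a Lyapunov function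
  for it.  Along a motion,
  \<open>V' = e\<^sup>T (G\<^sup>T P + P G) e + q(e) e\<^sup>T (P N\<^sub>c C + C\<^sup>T N\<^sub>c\<^sup>T P) e\<close>,
  and because \<open>q \<ge> 0\<close> and the second form is negative, the cubic term can only help: it may be
  dropped, and what remains is the estimate of a linear observer.

  Comparing definite forms with the squared norm (lemmas \<open>sym_pos_def_coercive\<close> and
  \<open>quadratic_form_le_norm\<close>) turns this into \<open>V' \<le> - k V\<close>, hence into
  \<open>norm (e t) \<le> K exp (- k t) norm (e 0)\<close> with \<open>k\<close> and \<open>K\<close> common to all motions and all time
  domains (lemma \<open>quadratic_lyapunov_decay\<close>).  This exponential bound contains all three parts
  of global asymptotic stability: stability of the origin, boundedness of motions on
  bounded time domains, and convergence to the origin.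
\<close>

section \<open>Quadratic forms and the squared norm\<close>

text \<open>
  A positive definite form attains a positive minimum on the unit sphere, which is compact;
  homogeneity of degree two carries the bound to all vectors.
\<close>
lemma sym_pos_def_coercive:
  fixes M :: "real ^ 'n ^ 'n"
  assumes "sym_pos_def M"
  obtains c where "c > 0" "\<And>v. c * (norm v)\<^sup>2 \<le> v \<bullet> (M *v v)"
proof -
  let ?S = "sphere (0 :: real ^ 'n) 1"
  have "continuous_on ?S (\<lambda>v. v \<bullet> (M *v v))"
    by (intro continuous_intros linear_continuous_on matrix_vector_mul_bounded_linear)
  then have "\<exists>u\<in>?S. \<forall>v\<in>?S. u \<bullet> (M *v u) \<le> v \<bullet> (M *v v)"
    by (intro continuous_attains_inf) simp_all
  then obtain u where u: "u \<in> ?S" "\<And>v. v \<in> ?S \<Longrightarrow> u \<bullet> (M *v u) \<le> v \<bullet> (M *v v)"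
    by blast
  show thesis
  proof
    from u(1) have "u \<noteq> 0" by auto
    then show "u \<bullet> (M *v u) > 0"
      using assms by (simp add: sym_pos_def_def)
    show "u \<bullet> (M *v u) * (norm v)\<^sup>2 \<le> v \<bullet> (M *v v)" for v
    proof (cases "v = 0")
      case False
      define z where "z = (1 / norm v) *\<^sub>R v"
      have v: "v = norm v *\<^sub>R z" and z: "z \<in> ?S"
        using False by (simp_all add: z_def)
      have "(r *\<^sub>R z) \<bullet> (M *v (r *\<^sub>R z)) = r\<^sup>2 * (z \<bullet> (M *v z))" for r
        by (simp add: matrix_vector_mult_scaleR power2_eq_square)
      from this[of "norm v"] have "v \<bullet> (M *v v) = (norm v)\<^sup>2 * (z \<bullet> (M *v z))"
        unfolding v[symmetric] .
      moreover have "(norm v)\<^sup>2 * (u \<bullet> (M *v u)) \<le> (norm v)\<^sup>2 * (z \<bullet> (M *v z))"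
        using u(2)[OF z] by (intro mult_left_mono) auto
      ultimately show ?thesis
        by (simp add: mult.commute)
    qed simp
  qed
qed

lemma uminus_matrix_vector_mult: "(- M) *v v = - (M *v v)" for M :: "real ^ 'n ^ 'm"
  by (simp add: vec_eq_iff matrix_vector_mult_def sum_negf)

lemma sym_neg_def_uminus:
  fixes M :: "real ^ 'n ^ 'n"
  assumes "sym_neg_def M"
  shows "sym_pos_def (- M)"
proof -
  have "transpose (- M) = - transpose M"
    by (simp add: vec_eq_iff transpose_def)
  then show ?thesis
    using assms by (auto simp: sym_neg_def_def sym_pos_def_def uminus_matrix_vector_mult)
qed

lemma quadratic_form_le_norm:
  fixes M :: "real ^ 'n ^ 'n"
  obtains b where "b > 0" "\<And>v. v \<bullet> (M *v v) \<le> b * (norm v)\<^sup>2"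
proof -
  obtain b where b: "b > 0" "\<And>v. norm (M *v v) \<le> norm v * b"
    using bounded_linear.pos_bounded[OF matrix_vector_mul_bounded_linear[of M]] by blast
  have "v \<bullet> (M *v v) \<le> b * (norm v)\<^sup>2" for v
  proof -
    have "v \<bullet> (M *v v) \<le> norm v * norm (M *v v)"
      by (rule norm_cauchy_schwarz)
    also have "\<dots> \<le> norm v * (norm v * b)"
      using b(2) by (intro mult_left_mono) auto
    finally show ?thesis
      by (simp add: power2_eq_square mult_ac)
  qed
  with b(1) show thesis by (rule that)
qed

text \<open>
  This is the form in which a Lyapunov inequality enters the derivative of a quadratic form.
\<close>
lemma inner_lyapunov_matrix:
  fixes P F :: "real ^ 'n ^ 'n"
  assumes "transpose P = P"
  shows "v \<bullet> ((transpose F ** P + P ** F) *v v) = 2 * (v \<bullet> (P *v (F *v v)))"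
proof -
  have "v \<bullet> ((transpose F ** P) *v v) = (F *v v) \<bullet> (P *v v)"
    by (metis dot_lmul_matrix matrix_vector_mul_assoc transpose_matrix_vector transpose_transpose)
  also have "\<dots> = v \<bullet> (P *v (F *v v))"
    by (metis assms dot_lmul_matrix inner_commute transpose_matrix_vector)
  finally show ?thesis
    by (simp add: matrix_vector_mult_add_rdistrib inner_add_right matrix_vector_mul_assoc)
qed

section \<open>Exponential decay along motions\<close>

text \<open>
  The product \<open>V s * exp (k * s)\<close> has a nonpositive derivative.  One-sided derivatives at the
  end points suffice, so the estimate applies on every time domain.
\<close>
lemma differential_inequality_decay:
  fixes V V' :: "real \<Rightarrow> real"
  assumes deriv: "\<And>s. s \<in> {0..t} \<Longrightarrow> (V has_real_derivative V' s) (at s within {0..t})"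
    and le: "\<And>s. s \<in> {0..t} \<Longrightarrow> V' s \<le> - k * V s"
    and "0 \<le> t"
  shows "V t \<le> V 0 * exp (- k * t)"
proof (cases "t = 0")
  case False
  with \<open>0 \<le> t\<close> have "0 < t" by simp
  let ?W = "\<lambda>s. V s * exp (k * s)"
  let ?W' = "\<lambda>s. (V' s + k * V s) * exp (k * s)"
  have "(?W has_derivative (*) (?W' s)) (at s within {0..t})" if "0 \<le> s" "s \<le> t" for s
    unfolding has_field_derivative_def[symmetric]
    using deriv[of s] that by (auto intro!: derivative_eq_intros simp: algebra_simps)
  from mvt_simple[OF \<open>0 < t\<close> this]
  obtain s where s: "s \<in> {0<..<t}" "?W t - ?W 0 = ?W' s * (t - 0)"
    by blast
  have "?W' s * (t - 0) \<le> 0"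
    using le[of s] s(1) by (intro mult_nonpos_nonneg) auto
  with s(2) have "V t * exp (k * t) \<le> V 0"
    by simp
  then show ?thesis
    by (simp add: exp_minus field_simps)
qed simp

lemma time_domain_atLeastAtMost:
  assumes "time_domain J" "t \<in> J"
  shows "{0..t} \<subseteq> J" "0 \<le> t"
  using assms by (auto simp: time_domain_def)

text \<open>
  Lyapunov's direct method for a quadratic form: the constants depend on the form and on the
  dissipation rate \<open>a\<close> alone, so the bound is uniform over the motions of \<open>f\<close>.
\<close>
lemma quadratic_lyapunov_decay:
  fixes P :: "real ^ 'n ^ 'n" and f :: "real ^ 'n \<Rightarrow> real ^ 'n"
  assumes P: "sym_pos_def P" and "a > 0"
    and dissipation: "\<And>v. 2 * (v \<bullet> (P *v f v)) \<le> - a * (norm v)\<^sup>2"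
  obtains K k where "K > 0" "k > 0"
    "\<And>J e t. time_domain J \<Longrightarrow>
       (\<And>s. s \<in> J \<Longrightarrow> (e has_vector_derivative f (e s)) (at s within J)) \<Longrightarrow>
       t \<in> J \<Longrightarrow> norm (e t) \<le> K * exp (- k * t) * norm (e 0)"
proof -
  obtain c where c: "c > 0" "\<And>v. c * (norm v)\<^sup>2 \<le> v \<bullet> (P *v v)"
    using sym_pos_def_coercive[OF P] by blast
  obtain b where b: "b > 0" "\<And>v. v \<bullet> (P *v v) \<le> b * (norm v)\<^sup>2"
    using quadratic_form_le_norm[of P] by blast
  define k where "k = a / b"
  have k: "k > 0" using \<open>a > 0\<close> b(1) by (simp add: k_def)
  show thesis
  proof
    show "sqrt (b / c) > 0" using b(1) c(1) by simp
    \<comment> \<open>The form decays at the rate \<open>k\<close>; the norm, at half of it.\<close>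
    show "k / 2 > 0" using k by simp
    fix J :: "real set" and e :: "real \<Rightarrow> real ^ 'n" and t
    assume J: "time_domain J" and t: "t \<in> J"
      and ode: "\<And>s. s \<in> J \<Longrightarrow> (e has_vector_derivative f (e s)) (at s within J)"
    note dom = time_domain_atLeastAtMost[OF J t]
    let ?V = "\<lambda>s. e s \<bullet> (P *v e s)"
    have "?V t \<le> ?V 0 * exp (- k * t)"
    proof (rule differential_inequality_decay)
      fix s assume s: "s \<in> {0..t}"
      have e': "(e has_vector_derivative f (e s)) (at s within {0..t})"
        using ode s dom(1) by (blast intro: has_vector_derivative_within_subset)
      have "((\<lambda>s. P *v e s) has_vector_derivative P *v f (e s)) (at s within {0..t})"
        using bounded_linear.has_vector_derivative[OF matrix_vector_mul_bounded_linear e'] .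
      from bounded_bilinear.has_vector_derivative[OF bounded_bilinear_inner e' this]
      have "(?V has_vector_derivative (e s \<bullet> (P *v f (e s)) + f (e s) \<bullet> (P *v e s)))
              (at s within {0..t})" .
      moreover have "f (e s) \<bullet> (P *v e s) = e s \<bullet> (P *v f (e s))"
        using P by (metis dot_lmul_matrix inner_commute sym_pos_def_def transpose_matrix_vector)
      ultimately show "(?V has_real_derivative 2 * (e s \<bullet> (P *v f (e s)))) (at s within {0..t})"
        by (simp add: has_real_derivative_iff_has_vector_derivative)
      have "k * ?V s \<le> k * (b * (norm (e s))\<^sup>2)"
        using b(2) k by (intro mult_left_mono) auto
      also have "\<dots> = a * (norm (e s))\<^sup>2"
        using b(1) by (simp add: k_def)
      finally show "2 * (e s \<bullet> (P *v f (e s))) \<le> - k * ?V s"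
        using dissipation[of "e s"] by simp
    qed (rule dom(2))
    also have "\<dots> \<le> b * (norm (e 0))\<^sup>2 * exp (- k * t)"
      using b(2) by (intro mult_right_mono) auto
    finally have "c * (norm (e t))\<^sup>2 \<le> b * (norm (e 0))\<^sup>2 * exp (- k * t)"
      using c(2)[of "e t"] by linarith
    then have "(norm (e t))\<^sup>2 \<le> b / c * exp (- k * t) * (norm (e 0))\<^sup>2"
      using c(1) by (simp add: field_simps)
    also have "\<dots> = (sqrt (b / c) * exp (- (k / 2) * t) * norm (e 0))\<^sup>2"
      using b(1) c(1) by (simp add: power_mult_distrib exp_double[symmetric])
    finally show "norm (e t) \<le> sqrt (b / c) * exp (- (k / 2) * t) * norm (e 0)"
      by (rule power2_le_imp_le) (use b(1) c(1) in simp)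
  qed
qed

lemma exponential_bound_imp_globally_asymptotically_stable:
  fixes S :: "(real set \<times> (real \<Rightarrow> 'a::real_normed_vector)) set"
  assumes "K > 0" "k > 0"
    and dom: "\<And>J e. (J, e) \<in> S \<Longrightarrow> time_domain J"
    and bound: "\<And>J e t. (J, e) \<in> S \<Longrightarrow> t \<in> J \<Longrightarrow> norm (e t) \<le> K * exp (- k * t) * norm (e 0)"
  shows "globally_asymptotically_stable S"
proof -
  have uniform: "norm (e t) \<le> K * norm (e 0)" if "(J, e) \<in> S" "t \<in> J" for J e t
  proof -
    have "0 \<le> t"
      using time_domain_atLeastAtMost(2)[OF dom[OF that(1)] that(2)] .
    with \<open>k > 0\<close> have "exp (- k * t) \<le> 1"
      by simp
    then have "K * exp (- k * t) * norm (e 0) \<le> K * 1 * norm (e 0)"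
      using \<open>K > 0\<close> by (intro mult_right_mono mult_left_mono) auto
    with bound[OF that] show ?thesis by simp
  qed
  have "lyapunov_stable S"
    unfolding lyapunov_stable_def
  proof (intro allI impI)
    fix \<epsilon> :: real assume "\<epsilon> > 0"
    show "\<exists>\<delta>>0. \<forall>(J, e)\<in>S. norm (e 0) < \<delta> \<longrightarrow> (\<forall>t\<in>J. norm (e t) < \<epsilon>)"
    proof (intro exI[of _ "\<epsilon> / K"] conjI)
      show "\<forall>(J, e)\<in>S. norm (e 0) < \<epsilon> / K \<longrightarrow> (\<forall>t\<in>J. norm (e t) < \<epsilon>)"
      proof clarify
        fix J e t assume "(J, e) \<in> S" "norm (e 0) < \<epsilon> / K" "t \<in> J"
        then show "norm (e t) < \<epsilon>"
          using uniform[of J e t] \<open>K > 0\<close> by (simp add: field_simps)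
      qed
    qed (use \<open>\<epsilon> > 0\<close> \<open>K > 0\<close> in simp)
  qed
  moreover have "globally_attractive S"
    unfolding globally_attractive_def
  proof clarify
    fix J e assume S: "(J, e) \<in> S"
    have "bounded (e ` J)"
      using uniform[OF S] by (auto simp: bounded_iff)
    moreover have "(e \<longlongrightarrow> 0) at_top" if "J = {0..}"
    proof (rule Lim_null_comparison)
      show "\<forall>\<^sub>F t in at_top. norm (e t) \<le> K * exp (- k * t) * norm (e 0)"
        using eventually_ge_at_top[of 0] by eventually_elim (use bound[OF S] that in auto)
      have "filterlim (\<lambda>t. - k * t) at_bot at_top"
        using \<open>k > 0\<close> by (intro filterlim_tendsto_neg_mult_at_bot[of _ "- k"] filterlim_ident) auto
      then have "((\<lambda>t. exp (- k * t)) \<longlongrightarrow> 0) at_top"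
        by (rule filterlim_compose[OF exp_at_bot])
      then have "((\<lambda>t. (K * norm (e 0)) * exp (- k * t)) \<longlongrightarrow> 0) at_top"
        by (rule tendsto_mult_right_zero)
      then show "((\<lambda>t. K * exp (- k * t) * norm (e 0)) \<longlongrightarrow> 0) at_top"
        by (simp only: mult.assoc mult.commute[of "norm (e 0)"])
    qed
    ultimately show "bounded (e ` J) \<and> (J = {0..} \<longrightarrow> (e \<longlongrightarrow> 0) at_top)"
      by blast
  qed
  ultimately show ?thesis
    by (simp add: globally_asymptotically_stable_def)
qed

section \<open>The cubic observer\<close>

text \<open>
  Condition (iv) removes the unknown input from the derivative of
  \<open>(I - E C) x - w\<close>, and condition (i) makes the terms in the state \<open>x\<close> combine with \<open>- G w\<close>
  into \<open>G e\<close>.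
\<close>
lemma error_dynamics_ode:
  fixes A G :: "real ^ 'n ^ 'n"
    and C :: "real ^ 'n ^ 'y"
    and Bd :: "real ^ 'd ^ 'n"
    and L E Nc :: "real ^ 'y ^ 'n"
    and \<theta> :: "real ^ 'y ^ 'y"
  assumes decoupled: "(mat 1 - E ** C) ** A - G ** (mat 1 - E ** C) - L ** C = 0"
    and input: "(mat 1 - E ** C) ** Bd = 0"
    and motion: "(J, e) \<in> error_dynamics A Bd C G L E Nc \<theta>"
    and t: "t \<in> J"
  shows "(e has_vector_derivative
           (G *v e t + (e t \<bullet> ((transpose C ** \<theta> ** C) *v e t)) *\<^sub>R ((Nc ** C) *v e t)))
         (at t within J)"
proof -
  let ?T = "mat 1 - E ** C"
  let ?r = "(e t \<bullet> ((transpose C ** \<theta> ** C) *v e t)) *\<^sub>R ((Nc ** C) *v e t)"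
  obtain d x y w xhat where plant: "plant_solution A Bd C J d x y"
    and obs: "cubic_observer_solution C G L E Nc \<theta> J y e w xhat"
    and err: "\<And>s. s \<in> J \<Longrightarrow> e s = x s - xhat s"
    using motion by (auto simp: error_dynamics_def)
  have e: "e s = ?T *v x s - w s" if "s \<in> J" for s
    using plant obs err[OF that] that
    by (simp add: plant_solution_def cubic_observer_solution_def matrix_vector_mult_diff_rdistrib
        matrix_vector_mul_assoc)
  have x': "(x has_vector_derivative (A *v x t + Bd *v d t)) (at t within J)"
    and y: "y t = C *v x t"
    using plant t by (auto simp: plant_solution_def)
  have w': "(w has_vector_derivative (G *v w t + L *v y t - ?r)) (at t within J)"
    using obs t by (auto simp: cubic_observer_solution_def)
  have "((\<lambda>s. ?T *v x s - w s) has_vector_derivative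
          ?T *v (A *v x t + Bd *v d t) - (G *v w t + L *v y t - ?r)) (at t within J)"
    using bounded_linear.has_vector_derivative[OF matrix_vector_mul_bounded_linear x'] w'
    by (rule has_vector_derivative_diff)
  moreover have "?T *v (A *v x t + Bd *v d t) - (G *v w t + L *v y t - ?r) = G *v e t + ?r"
  proof -
    have "?T ** A = G ** ?T + L ** C"
      using decoupled by (simp add: algebra_simps)
    then have "?T *v (A *v x t) = G *v (?T *v x t) + L *v y t"
      by (simp add: y matrix_vector_mul_assoc matrix_vector_mult_add_rdistrib)
    moreover have "?T *v (Bd *v d t) = 0"
      using input by (simp add: matrix_vector_mul_assoc)
    ultimately show ?thesis
      using e[OF t] by (simp add: matrix_vector_right_distrib matrix_vector_mult_diff_distrib)
  qed
  ultimately show ?thesis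
    using has_vector_derivative_transform[OF t e] by simp
qed

theorem theorem5:
  fixes A G P :: "real ^ 'n ^ 'n"
    and C :: "real ^ 'n ^ 'y"
    and Bd :: "real ^ 'd ^ 'n"
    and L E Nc :: "real ^ 'y ^ 'n"
    and \<theta> :: "real ^ 'y ^ 'y"
  assumes "sym_pos_def P"
    and "sym_pos_semidef (transpose C ** \<theta> ** C)"
    and "(mat 1 - E ** C) ** A - G ** (mat 1 - E ** C) - L ** C = 0"
    and "\<nexists>v. v \<noteq> 0 \<and>
           G *v v + (v \<bullet> ((transpose C ** \<theta> ** C) *v v)) *\<^sub>R ((Nc ** C) *v v) = 0"
    and "sym_neg_def (transpose G ** P + P ** G)"
    and "sym_neg_def (P ** Nc ** C + transpose C ** transpose Nc ** P)"
    and "(mat 1 - E ** C) ** Bd = 0"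
  shows "globally_asymptotically_stable (error_dynamics A Bd C G L E Nc \<theta>)"
proof -
  let ?Q = "transpose C ** \<theta> ** C"
  let ?f = "\<lambda>v. G *v v + (v \<bullet> (?Q *v v)) *\<^sub>R ((Nc ** C) *v v)"
  have sym: "transpose P = P"
    using assms(1) by (simp add: sym_pos_def_def)
  obtain a where a: "a > 0"
    "\<And>v. a * (norm v)\<^sup>2 \<le> v \<bullet> (- (transpose G ** P + P ** G) *v v)"
    using sym_pos_def_coercive[OF sym_neg_def_uminus[OF assms(5)]] by blast
  have dissipation: "2 * (v \<bullet> (P *v ?f v)) \<le> - a * (norm v)\<^sup>2" for v
  proof -
    have linear: "2 * (v \<bullet> (P *v (G *v v))) \<le> - a * (norm v)\<^sup>2"
      using a(2)[of v]
      unfolding uminus_matrix_vector_mult inner_minus_right inner_lyapunov_matrix[OF sym]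
      by simp
    have "2 * (v \<bullet> (P *v ((Nc ** C) *v v)))
        = v \<bullet> ((P ** Nc ** C + transpose C ** transpose Nc ** P) *v v)"
      using inner_lyapunov_matrix[OF sym, of v "Nc ** C"]
      by (simp add: matrix_transpose_mul matrix_mul_assoc add.commute)
    also have "\<dots> \<le> 0"
      using assms(6) by (cases "v = 0") (auto simp: sym_neg_def_def intro: less_imp_le)
    finally have cubic: "v \<bullet> (P *v ((Nc ** C) *v v)) \<le> 0"
      by simp
    have "v \<bullet> (?Q *v v) \<ge> 0"
      using assms(2) by (simp add: sym_pos_semidef_def)
    with cubic have "(v \<bullet> (?Q *v v)) * (v \<bullet> (P *v ((Nc ** C) *v v))) \<le> 0"
      by (simp add: mult_nonneg_nonpos)
    with linear show ?thesis
      by (simp add: matrix_vector_right_distrib matrix_vector_mult_scaleR inner_add_right)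
  qed
  obtain K k where Kk: "K > 0" "k > 0"
    and decay: "\<And>J e t. time_domain J \<Longrightarrow>
       (\<And>s. s \<in> J \<Longrightarrow> (e has_vector_derivative ?f (e s)) (at s within J)) \<Longrightarrow>
       t \<in> J \<Longrightarrow> norm (e t) \<le> K * exp (- k * t) * norm (e 0)"
    using quadratic_lyapunov_decay[OF assms(1) a(1) dissipation] by blast
  have domain: "time_domain J" if "(J, e) \<in> error_dynamics A Bd C G L E Nc \<theta>" for J e
    using that by (simp add: error_dynamics_def)
  show ?thesis
  proof (rule exponential_bound_imp_globally_asymptotically_stable[OF Kk domain])
    fix J e t assume m: "(J, e) \<in> error_dynamics A Bd C G L E Nc \<theta>" and t: "t \<in> J"
    show "norm (e t) \<le> K * exp (- k * t) * norm (e 0)"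
      using decay[OF domain[OF m] error_dynamics_ode[OF assms(3,7) m] t] .
  qed
qed

end
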